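(* Let $\mathcal G=(\mathcal V,\mathcal E,\omega)$ be a connected weighted hypergraph, let $\mathbf G$, $\mathbf A_\theta$, $a_{\min}$, $\phi$, $\mathcal S_\phi$, $\mathbf Q_\phi$ be as defined in the context, and let $\{\mathbf S_D(t)\}_{t\ge 0}$ be the diffusion semiflow on $\mathcal X=\mathbb R^{n\times d}$ generated by $$\frac{d\mathbf X(t)}{dt}=-\mathbf G^\top \mathbf A_\theta(\mathbf X(t))\,\mathbf G\,\mathbf X(t),\qquad \mathbf X(0)=\mathbf X_0 .$$ Then the subspace $\mathcal S_\phi$ is invariant under $\{\mathbf S_D(t)\}_{t\ge0}$, i.e. $\mathbf S_D(t)\mathcal S_\phi=\mathcal S_\phi$ for all $t\ge 0$. Moreover, let $$\lambda_2:=\min_{\mathbf Z\in\mathcal S_\phi^\perp,\ \|\mathbf Z\|_F=1}\|\mathbf G\mathbf Z\|_F^2 .$$ Then $\lambda_2>0$, and for every $\mathbf X_0\in\mathcal X$ and all $t\ge 0$, $$\operatorname{dist}(\mathbf S_D(t)\mathbf X_0,\mathcal S_\phi)=\|\mathbf Q_\phi\mathbf S_D(t)\mathbf X_0\|_F\le e^{-\gamma_D t}\,\|\mathbf Q_\phi\mathbf X_0\|_F,\qquad \gamma_D:=a_{\min}\lambda_2>0 .$$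
   Context: Hypergraph. $\mathcal V$ is a finite set of $n\ge 2$ nodes, $\mathcal E$ a finite set of hyperedges, each $e\in\mathcal E$ being a subset of $\mathcal V$ with $|e|\ge 2$, and $\omega_e>0$ is the weight of $e$. The degree of $v$ is $d_v=\#\{e\in\mathcal E: v\in e\}$ (unweighted) and $d_{\max}=\max_v d_v$. The hypergraph is connected if any two nodes can be joined by a finite sequence of nodes in which consecutive nodes lie in a common hyperedge; then $d_v\ge 1$ for all $v$. The incidence set is $\mathcal I=\{(e,v): e\in\mathcal E, v\in e\}$ and $N=|\mathcal I|$. Phase space. $\mathcal X=\mathbb R^{n\times d}$ with Frobenius inner product $\langle\cdot,\cdot\rangle_F$ and norm $\|\cdot\|_F$; row $\mathbf X_v$ of $\mathbf X$ is the representation of node $v$. $\operatorname{dist}(\mathbf X,\mathcal S)=\inf_{\mathbf Y\in\mathcal S}\|\mathbf X-\mathbf Y\|_F$. Gradient matrix. $\mathbf G\in\mathbb R^{N\times n}$ is $\mathbf G=\mathbf\Omega_{\mathcal I}^{1/2}\mathbf P$, where $\mathbf\Omega_{\mathcal I}=\operatorname{diag}(\omega_e)_{(e,v)\in\mathcal I}$ and $(\mathbf P\mathbf f)(e,v)=\frac{\mathbf f(v)}{\sqrt{d_v}}-\frac1{|e|}\sum_{u\in e}\frac{\mathbf f(u)}{\sqrt{d_u}}$; it acts on $\mathbf X\in\mathcal X$ columnwise. Modulation. Fix parameters $\theta$ and $0<\varepsilon<1$. For $\mathbf X\in\mathcal X$ let $\mathbf X_e=\operatorname{Agg}(\{\mathbf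 X_u:u\in e\})\in\mathbb R^d$, with $\operatorname{Agg}$ a permutation-invariant, locally Lipschitz aggregator (such as mean or max pooling), and $r^\theta_{(e,v)}=\sigma(\operatorname{MLP}_\theta(\mathbf X_v\,\|\,\mathbf X_e))\in\mathbb R$, where $\|$ is concatenation, $\sigma$ is LeakyReLU and $\operatorname{MLP}_\theta:\mathbb R^{2d}\to\mathbb R$ is a (locally Lipschitz) multilayer perceptron. Set $$a_\theta(\mathbf X_v,\mathbf X_e)=(1-\varepsilon)\frac{\exp(r^\theta_{(e,v)})}{\sum_{e'\ni v}\exp(r^\theta_{(e',v)})}+\frac{\varepsilon}{d_v},\qquad \mathbf A_\theta(\mathbf X)=\operatorname{diag}(a_\theta(\mathbf X_v,\mathbf X_e))_{(e,v)\in\mathcal I}\in\mathbb R^{N\times N},\qquad a_{\min}:=\varepsilon/d_{\max}.$$ Null mode. $\mathbf D_v=\operatorname{diag}(d_v)_{v\in\mathcal V}$, $\phi=\mathbf D_v^{1/2}\mathbf 1\in\mathbb R^n$, $\mathcal S_\phi=\{\phi c: c\in\mathbb R^{1\times d}\}\subset\mathcal X$; $\mathcal S_\phi^\perp$ is its orthogonal complement in $\mathcal X$, $\mathbf\Pi_\phi$ the orthogonal projector onto $\mathcal S_\phi$, and $\mathbf Q_\phi=\mathbf I-\mathbf\Pi_\phi$. Semiflow. It is known that for every $\mathbf X_0\in\mathcal X$ the diffusion equation has a unique global classical ($C^1$ on $[0,\infty)$) solution $\mathbf X(t;\mathbf X_0)$, and $\mathbf S_D(t)\mathbf X_0:=\mathbf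 X(t;\mathbf X_0)$ defines a continuous semiflow on $\mathcal X$. *)

theory Defs
  imports "HOL-Analysis.Analysis" "HOL-Library.Multiset"
begin

section \<open>Weighted hypergraphs\<close>

text \<open>
  The node set is the whole of a finite type \<^typ>\<open>'v\<close>, so the number of nodes is the cardinality
  of that type. Hyperedges are sets of nodes.
\<close>

definition weighted_hypergraph :: "'v::finite set set \<Rightarrow> ('v set \<Rightarrow> real) \<Rightarrow> bool" where
  "weighted_hypergraph E \<omega> \<longleftrightarrow>
     CARD('v) \<ge> 2 \<and> (\<forall>e\<in>E. card e \<ge> 2) \<and> (\<forall>e\<in>E. \<omega> e > 0)"

definition hypergraph_connected :: "'v::finite set set \<Rightarrow> bool" where
  "hypergraph_connected E \<longleftrightarrow>
     (\<forall>u v. (u, v) \<in> {(x, y). \<exists>e\<in>E. x \<in> e \<and> y \<in> e}\<^sup>*)"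

definition deg :: "'v::finite set set \<Rightarrow> 'v \<Rightarrow> nat" where
  "deg E v = card {e \<in> E. v \<in> e}"

definition max_deg :: "'v::finite set set \<Rightarrow> nat" where
  "max_deg E = Max (range (deg E))"

definition incidences :: "'v::finite set set \<Rightarrow> ('v set \<times> 'v) set" where
  "incidences E = {(e, v). e \<in> E \<and> v \<in> e}"


section \<open>Gradient matrix\<close>

text \<open>
  Matrices whose rows or columns run over the incidence set are indexed by all of
  \<^typ>\<open>'v set \<times> 'v\<close>; the entries outside the incidence set are zero. This padding changes neither
  the products of such matrices nor their norms.
\<close>

definition diag_matrix :: "('i::finite \<Rightarrow> real) \<Rightarrow> real^'i^'i" where
  "diag_matrix f = (\<chi> i j. if i = j then f i else 0)"

definition P_map :: "'v::finite set set \<Rightarrow> real^'v \<Rightarrow> real^('v set \<times> 'v)" where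
  "P_map E f = (\<chi> i. case i of (e, v) \<Rightarrow>
     if (e, v) \<in> incidences E
     then f $ v / sqrt (deg E v) - (\<Sum>u\<in>e. f $ u / sqrt (deg E u)) / card e
     else 0)"

definition P_matrix :: "'v::finite set set \<Rightarrow> real^'v^('v set \<times> 'v)" where
  "P_matrix E = matrix (P_map E)"

lemma linear_P_map: "linear (P_map E)"
  by (rule linearI)
     (auto simp: P_map_def vec_eq_iff add_divide_distrib sum.distrib diff_divide_distrib
       right_diff_distrib sum_distrib_left)

lemma P_matrix_works: "P_matrix E *v f = P_map E f"
  by (simp add: P_matrix_def matrix_works linear_P_map)

definition sqrt_weight_matrix ::
    "'v::finite set set \<Rightarrow> ('v set \<Rightarrow> real) \<Rightarrow> real^('v set \<times> 'v)^('v set \<times> 'v)" where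
  "sqrt_weight_matrix E \<omega> =
     diag_matrix (\<lambda>(e, v). if (e, v) \<in> incidences E then sqrt (\<omega> e) else 0)"

definition grad_matrix ::
    "'v::finite set set \<Rightarrow> ('v set \<Rightarrow> real) \<Rightarrow> real^'v^('v set \<times> 'v)" where
  "grad_matrix E \<omega> = sqrt_weight_matrix E \<omega> ** P_matrix E"


section \<open>Modulation\<close>

definition locally_lipschitz :: "('a::metric_space \<Rightarrow> 'b::metric_space) \<Rightarrow> bool" where
  "locally_lipschitz f \<longleftrightarrow> local_lipschitz (UNIV :: real set) UNIV (\<lambda>_. f)"

definition leaky_relu :: "real \<Rightarrow> real \<Rightarrow> real" where
  "leaky_relu \<alpha> x = (if x \<ge> 0 then x else \<alpha> * x)"

text \<open>
  Parameters of a scalar-valued fully connected network with input in \<^typ>\<open>real^'k\<close>. The hidden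
  layers are numbered \<open>0, \<dots>, last_layer\<close>, hidden layer \<open>l\<close> has \<open>width l\<close> neurons, and
  \<open>weight l i j\<close> leads from neuron \<open>j\<close> of layer \<open>l\<close> to neuron \<open>i\<close> of layer \<open>Suc l\<close>.
\<close>

record ('k::finite) mlp_params =
  last_layer :: nat
  width :: "nat \<Rightarrow> nat"
  in_weight :: "nat \<Rightarrow> real^'k"
  weight :: "nat \<Rightarrow> nat \<Rightarrow> nat \<Rightarrow> real"
  bias :: "nat \<Rightarrow> nat \<Rightarrow> real"
  out_weight :: "nat \<Rightarrow> real"
  out_bias :: real

text \<open>The activation \<open>act l\<close> is applied to every neuron of hidden layer \<open>l\<close>.\<close>

primrec mlp_hidden ::
    "(nat \<Rightarrow> real \<Rightarrow> real) \<Rightarrow> 'k::finite mlp_params \<Rightarrow> real^'k \<Rightarrow> nat \<Rightarrow> nat \<Rightarrow> real" where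
  "mlp_hidden act \<theta> x 0 = (\<lambda>i. act 0 (in_weight \<theta> i \<bullet> x + bias \<theta> 0 i))"
| "mlp_hidden act \<theta> x (Suc l) =
     (\<lambda>i. act (Suc l)
        ((\<Sum>j<width \<theta> l. weight \<theta> l i j * mlp_hidden act \<theta> x l j) + bias \<theta> (Suc l) i))"

definition mlp ::
    "(nat \<Rightarrow> real \<Rightarrow> real) \<Rightarrow> 'k::finite mlp_params \<Rightarrow> real^'k \<Rightarrow> real" where
  "mlp act \<theta> x =
     (\<Sum>j<width \<theta> (last_layer \<theta>). out_weight \<theta> j * mlp_hidden act \<theta> x (last_layer \<theta>) j)
     + out_bias \<theta>"

definition vec_concat :: "real^'a::finite \<Rightarrow> real^'b::finite \<Rightarrow> real^('a + 'b)" where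
  "vec_concat x y = (\<chi> i. case i of Inl j \<Rightarrow> x $ j | Inr j \<Rightarrow> y $ j)"

text \<open>
  An aggregator is a function of the multiset of the rows belonging to a hyperedge, which makes it
  permutation invariant.
\<close>

definition edge_feature ::
    "((real^'d::finite) multiset \<Rightarrow> real^'d) \<Rightarrow> real^'d^'v::finite \<Rightarrow> 'v set \<Rightarrow> real^'d" where
  "edge_feature Agg X e = Agg (image_mset (\<lambda>u. X $ u) (mset_set e))"

definition attn_score ::
    "real \<Rightarrow> ((real^'d::finite) multiset \<Rightarrow> real^'d) \<Rightarrow> (nat \<Rightarrow> real \<Rightarrow> real) \<Rightarrow>
     ('d + 'd) mlp_params \<Rightarrow> real^'d^'v::finite \<Rightarrow> 'v set \<Rightarrow> 'v \<Rightarrow> real" where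
  "attn_score \<alpha> Agg act \<theta> X e v =
     leaky_relu \<alpha> (mlp act \<theta> (vec_concat (X $ v) (edge_feature Agg X e)))"

definition attn_coeff ::
    "'v::finite set set \<Rightarrow> real \<Rightarrow> real \<Rightarrow> ((real^'d::finite) multiset \<Rightarrow> real^'d) \<Rightarrow>
     (nat \<Rightarrow> real \<Rightarrow> real) \<Rightarrow> ('d + 'd) mlp_params \<Rightarrow> real^'d^'v \<Rightarrow> 'v set \<Rightarrow> 'v \<Rightarrow> real" where
  "attn_coeff E \<epsilon> \<alpha> Agg act \<theta> X e v =
     (1 - \<epsilon>) * (exp (attn_score \<alpha> Agg act \<theta> X e v) /
       (\<Sum>e' \<in> {e' \<in> E. v \<in> e'}. exp (attn_score \<alpha> Agg act \<theta> X e' v)))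
     + \<epsilon> / deg E v"

definition mod_matrix ::
    "'v::finite set set \<Rightarrow> real \<Rightarrow> real \<Rightarrow> ((real^'d::finite) multiset \<Rightarrow> real^'d) \<Rightarrow>
     (nat \<Rightarrow> real \<Rightarrow> real) \<Rightarrow> ('d + 'd) mlp_params \<Rightarrow> real^'d^'v \<Rightarrow>
     real^('v set \<times> 'v)^('v set \<times> 'v)" where
  "mod_matrix E \<epsilon> \<alpha> Agg act \<theta> X =
     diag_matrix (\<lambda>(e, v). if (e, v) \<in> incidences E
       then attn_coeff E \<epsilon> \<alpha> Agg act \<theta> X e v else 0)"

definition a_min :: "'v::finite set set \<Rightarrow> real \<Rightarrow> real" where
  "a_min E \<epsilon> = \<epsilon> / max_deg E"


section \<open>Null mode\<close>

text \<open>
  The phase space is \<^typ>\<open>real^'d^'v\<close>, whose library inner product and norm are those of Frobenius;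
  \<open>X $ v\<close> is the row of node \<open>v\<close>.
\<close>

definition null_vec :: "'v::finite set set \<Rightarrow> real^'v" where
  "null_vec E = diag_matrix (\<lambda>v. sqrt (deg E v)) *v 1"

definition null_space :: "'v::finite set set \<Rightarrow> (real^'d::finite^'v) set" where
  "null_space E = {(\<chi> v. null_vec E $ v *\<^sub>R c) | c. True}"

definition orth_proj :: "'a::real_inner set \<Rightarrow> 'a \<Rightarrow> 'a" where
  "orth_proj W x = (THE y. y \<in> W \<and> x - y \<in> W\<^sup>\<bottom>)"

definition Q_proj :: "'v::finite set set \<Rightarrow> real^'d::finite^'v \<Rightarrow> real^'d^'v" where
  "Q_proj E X = X - orth_proj (null_space E) X"

definition energy_values ::
    "'v::finite set set \<Rightarrow> ('v set \<Rightarrow> real) \<Rightarrow> 'd::finite itself \<Rightarrow> real set" where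
  "energy_values E \<omega> _ =
     {(norm (grad_matrix E \<omega> ** Z))\<^sup>2 | Z :: real^'d^'v. Z \<in> (null_space E)\<^sup>\<bottom> \<and> norm Z = 1}"

definition lambda2 ::
    "'v::finite set set \<Rightarrow> ('v set \<Rightarrow> real) \<Rightarrow> 'd::finite itself \<Rightarrow> real" where
  "lambda2 E \<omega> d = Inf (energy_values E \<omega> d)"


section \<open>Diffusion semiflow\<close>

definition diffusion_field ::
    "'v::finite set set \<Rightarrow> ('v set \<Rightarrow> real) \<Rightarrow> real \<Rightarrow> real \<Rightarrow>
     ((real^'d::finite) multiset \<Rightarrow> real^'d) \<Rightarrow> (nat \<Rightarrow> real \<Rightarrow> real) \<Rightarrow> ('d + 'd) mlp_params \<Rightarrow>
     real^'d^'v \<Rightarrow> real^'d^'v" where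
  "diffusion_field E \<omega> \<epsilon> \<alpha> Agg act \<theta> X =
     - (transpose (grad_matrix E \<omega>) ** mod_matrix E \<epsilon> \<alpha> Agg act \<theta> X ** grad_matrix E \<omega> ** X)"

definition classical_solution ::
    "('a::real_normed_vector \<Rightarrow> 'a) \<Rightarrow> 'a \<Rightarrow> (real \<Rightarrow> 'a) \<Rightarrow> bool" where
  "classical_solution F x0 x \<longleftrightarrow> x 0 = x0 \<and>
     (\<exists>x'. continuous_on {0..} x' \<and>
       (\<forall>t\<ge>0. (x has_vector_derivative x' t) (at t within {0..}) \<and> x' t = F (x t)))"

text \<open>Semiflows are total functions of time, but only nonnegative times are constrained.\<close>

definition continuous_semiflow :: "(real \<Rightarrow> 'a::topological_space \<Rightarrow> 'a) \<Rightarrow> bool" where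
  "continuous_semiflow S \<longleftrightarrow>
     (\<forall>x. S 0 x = x) \<and>
     (\<forall>s\<ge>0. \<forall>t\<ge>0. \<forall>x. S (s + t) x = S s (S t x)) \<and>
     continuous_on ({0..} \<times> UNIV) (\<lambda>(t, x). S t x)"

definition semiflow_generated_by ::
    "('a::real_normed_vector \<Rightarrow> 'a) \<Rightarrow> (real \<Rightarrow> 'a \<Rightarrow> 'a) \<Rightarrow> bool" where
  "semiflow_generated_by F S \<longleftrightarrow>
     continuous_semiflow S \<and> (\<forall>x0. classical_solution F x0 (\<lambda>t. S t x0))"

end

theory Submission
  imports Defs
begin

text \<open>
  The kernel of \<open>G\<close> is exactly the null space: connectedness forces \<open>f v / sqrt (deg v)\<close> to be
  constant. Hence \<open>\<parallel>G Z\<parallel>\<^sup>2\<close> attains a positive minimum \<open>\<lambda>\<^sub>2\<close> on the unit sphere of the orthogonal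
  complement. Along a solution,
  \<open>d/dt \<parallel>Q X\<parallel>\<^sup>2 = - 2 \<langle>G X, A G X\<rangle> \<le> - 2 a\<^sub>m\<^sub>i\<^sub>n \<parallel>G Q X\<parallel>\<^sup>2 \<le> - 2 \<gamma> \<parallel>Q X\<parallel>\<^sup>2\<close>, which gives the decay.
  In particular a solution starting in the null space stays there, where the field vanishes; so
  it is constant, without any appeal to uniqueness of solutions.
\<close>

section \<open>Orthogonal projection onto a subspace\<close>

text \<open>A subspace meets its orthogonal complement only in 0, and the difference of two
  candidates lies in both. This is what gives the \<open>THE\<close> in \<open>orth_proj\<close> a
  value; the later facts about \<open>orth_proj\<close> rest on it.\<close>

lemma orth_proj_unique:
  fixes W :: "'a::real_inner set"
  assumes W: "subspace W" and y: "y \<in> W" "x - y \<in> W\<^sup>\<bottom>"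
  shows "orth_proj W x = y"
  unfolding orth_proj_def
proof (rule the_equality)
  fix z assume z: "z \<in> W \<and> x - z \<in> W\<^sup>\<bottom>"
  have "z - y \<in> W" using W y z by (simp add: subspace_diff)
  moreover have "z - y \<in> W\<^sup>\<bottom>"
    using subspace_diff[OF subspace_orthogonal_comp y(2) conjunct2[OF z]] by simp
  ultimately have "(z - y) \<bullet> (z - y) = 0"
    by (auto simp: orthogonal_comp_def orthogonal_def)
  then show "z = y" by simp
qed (use y in simp)

lemma orth_proj_exists:
  fixes W :: "'a::euclidean_space set"
  assumes W: "subspace W"
  shows "orth_proj W x \<in> W" and "x - orth_proj W x \<in> W\<^sup>\<bottom>"
proof -
  obtain y z where y: "y \<in> span W" and z: "\<And>w. w \<in> span W \<Longrightarrow> orthogonal z w"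
    and x: "x = y + z"
    using orthogonal_subspace_decomp_exists[of W x] by metis
  have "y \<in> W" using y W by (metis span_eq_iff)
  moreover have "x - y \<in> W\<^sup>\<bottom>"
    using z x by (auto simp: orthogonal_comp_def orthogonal_commute span_base)
  ultimately show "orth_proj W x \<in> W" "x - orth_proj W x \<in> W\<^sup>\<bottom>"
    using orth_proj_unique[OF W] by auto
qed

text \<open>Sums and multiples of projections again satisfy the characterisation of a projection, so
  uniqueness identifies them.\<close>

lemma linear_orth_proj:
  fixes W :: "'a::euclidean_space set"
  assumes W: "subspace W"
  shows "linear (orth_proj W)"
proof (rule linearI)
  note p = orth_proj_exists[OF W]
  fix x y :: 'a and c :: real
  show "orth_proj W (x + y) = orth_proj W x + orth_proj W y"
  proof (rule orth_proj_unique[OF W])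
    show "x + y - (orth_proj W x + orth_proj W y) \<in> W\<^sup>\<bottom>"
      using subspace_add[OF subspace_orthogonal_comp p(2)[of x] p(2)[of y]]
      by (simp add: algebra_simps)
  qed (simp add: p W subspace_add)
  show "orth_proj W (c *\<^sub>R x) = c *\<^sub>R orth_proj W x"
  proof (rule orth_proj_unique[OF W])
    show "c *\<^sub>R x - c *\<^sub>R orth_proj W x \<in> W\<^sup>\<bottom>"
      using subspace_scale[OF subspace_orthogonal_comp p(2)[of x], of c]
      by (simp add: algebra_simps)
  qed (simp add: p W subspace_scale)
qed

text \<open>Pythagoras: for \<open>y\<close> in \<open>W\<close>, \<open>x - y\<close> splits
  orthogonally into the fixed residual of \<open>x\<close> and a vector of \<open>W\<close>, so no
  point of \<open>W\<close> is closer than the projection.\<close>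

lemma infdist_subspace:
  fixes W :: "'a::euclidean_space set"
  assumes W: "subspace W"
  shows "infdist x W = norm (x - orth_proj W x)"
proof (rule antisym)
  note p = orth_proj_exists[OF W, of x]
  show "infdist x W \<le> norm (x - orth_proj W x)"
    using infdist_le[OF p(1)] by (simp add: dist_norm)
  have "norm (x - orth_proj W x) \<le> dist x y" if y: "y \<in> W" for y
  proof -
    have "orth_proj W x - y \<in> W" using p(1) y W by (simp add: subspace_diff)
    then have "orthogonal (x - orth_proj W x) (orth_proj W x - y)"
      using p(2) by (auto simp: orthogonal_comp_def intro: orthogonal_commute[THEN iffD1])
    then have "(norm (x - y))\<^sup>2 = (norm (x - orth_proj W x))\<^sup>2 + (norm (orth_proj W x - y))\<^sup>2"
      using norm_add_Pythagorean by fastforce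
    then show ?thesis
      by (metis dist_norm le_add_same_cancel1 norm_ge_zero power2_le_imp_le zero_le_power2)
  qed
  \<comment> \<open>\<open>infdist\<close> to the empty set is 0 by convention; only for nonempty
    \<open>W\<close> is it an infimum.\<close>
  moreover have "W \<noteq> {}" using p(1) by auto
  ultimately show "norm (x - orth_proj W x) \<le> infdist x W"
    by (auto simp: infdist_def intro!: cINF_greatest)
qed


section \<open>Frobenius inner product and matrices\<close>

lemma diag_matrix_mult_nth: "(diag_matrix f ** Y) $ i = f i *\<^sub>R (Y $ i)"
  by (simp add: diag_matrix_def matrix_matrix_mult_def vec_eq_iff if_distrib if_distribR
      cong: if_cong)

text \<open>The transpose is the adjoint for the Frobenius inner product. The swaps only bring the
  row index of \<open>G\<close> to the outside.\<close>

lemma inner_transpose_mult: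
  fixes G :: "real^'n::finite^'m::finite" and X :: "real^'d::finite^'n" and Y :: "real^'d^'m"
  shows "X \<bullet> (transpose G ** Y) = (G ** X) \<bullet> Y"
proof -
  have "X \<bullet> (transpose G ** Y) = (\<Sum>i\<in>UNIV. \<Sum>j\<in>UNIV. \<Sum>k\<in>UNIV. X$i$j * (G$k$i * Y$k$j))"
    by (simp add: inner_vec_def matrix_matrix_mult_def transpose_def sum_distrib_left)
  also have "\<dots> = (\<Sum>i\<in>UNIV. \<Sum>k\<in>UNIV. \<Sum>j\<in>UNIV. X$i$j * (G$k$i * Y$k$j))"
    by (intro sum.cong refl sum.swap)
  also have "\<dots> = (\<Sum>k\<in>UNIV. \<Sum>i\<in>UNIV. \<Sum>j\<in>UNIV. X$i$j * (G$k$i * Y$k$j))"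
    by (rule sum.swap)
  also have "\<dots> = (\<Sum>k\<in>UNIV. \<Sum>j\<in>UNIV. \<Sum>i\<in>UNIV. X$i$j * (G$k$i * Y$k$j))"
    by (intro sum.cong refl sum.swap)
  also have "\<dots> = (G ** X) \<bullet> Y"
    by (simp add: inner_vec_def matrix_matrix_mult_def sum_distrib_left sum_distrib_right
        mult_ac)
  finally show ?thesis .
qed

lemma linear_matrix_mult_left:
  fixes G :: "real^'n::finite^'m::finite"
  shows "linear (\<lambda>X :: real^'d::finite^'n. G ** X)"
  by (rule linearI)
     (simp_all add: matrix_matrix_mult_def vec_eq_iff
      sum_distrib_left sum.distrib algebra_simps)


section \<open>The gradient and its kernel\<close>

text \<open>There is a second node, and the first step of a path from \<open>v\<close> to it takes
  place in a hyperedge containing \<open>v\<close>. This makes the divisions by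
  \<open>sqrt (deg E v)\<close> meaningful.\<close>

lemma connected_deg_pos:
  assumes "weighted_hypergraph E \<omega>" "hypergraph_connected E"
  shows "deg E (v :: 'v::finite) > 0"
proof -
  have "\<exists>u :: 'v. u \<noteq> v"
  proof (rule ccontr)
    assume "\<not> ?thesis"
    then have "(UNIV :: 'v set) = {v}" by auto
    then have "CARD('v) = 1" by (metis card_1_singleton_iff One_nat_def)
    then show False using assms(1) by (simp add: weighted_hypergraph_def)
  qed
  then obtain u where "u \<noteq> v" by auto
  moreover have "(v, u) \<in> {(x, y). \<exists>e\<in>E. x \<in> e \<and> y \<in> e}\<^sup>*"
    using assms(2) by (simp add: hypergraph_connected_def)
  ultimately obtain e where "e \<in> E" "v \<in> e"
    by (auto elim: converse_rtranclE)
  then show ?thesis by (auto simp: deg_def card_gt_0_iff)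
qed

lemma P_matrix_mult_nth:
  fixes X :: "real^'d::finite^'v::finite"
  shows "(P_matrix E ** X) $ (e, v) =
    (if (e, v) \<in> incidences E
     then X $ v /\<^sub>R sqrt (deg E v) - (\<Sum>u\<in>e. X $ u /\<^sub>R sqrt (deg E u)) /\<^sub>R card e
     else 0)"
proof -
  \<comment> \<open>The matrix acts columnwise, so each coordinate reduces to \<open>P_map\<close>
    on one column.\<close>
  have "(P_matrix E ** X) $ (e, v) $ j = P_map E (column j X) $ (e, v)" for j
    by (simp add: P_matrix_works[symmetric] matrix_matrix_mult_def matrix_vector_mult_def
        column_def)
  then show ?thesis
    by (simp add: vec_eq_iff P_map_def column_def divide_inverse_commute)
qed

lemma grad_mult_nth:
  fixes X :: "real^'d::finite^'v::finite"
  shows "(grad_matrix E \<omega> ** X) $ (e, v) =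
    (if (e, v) \<in> incidences E
     then sqrt (\<omega> e) *\<^sub>R
       (X $ v /\<^sub>R sqrt (deg E v) - (\<Sum>u\<in>e. X $ u /\<^sub>R sqrt (deg E u)) /\<^sub>R card e)
     else 0)"
  by (simp add: grad_matrix_def sqrt_weight_matrix_def matrix_mul_assoc[symmetric]
      diag_matrix_mult_nth P_matrix_mult_nth)

lemma null_vec_nth: "null_vec E $ v = sqrt (deg E v)"
  by (simp add: null_vec_def diag_matrix_def matrix_vector_mult_def if_distrib if_distribR
      cong: if_cong)

lemma null_space_iff:
  "X \<in> null_space E \<longleftrightarrow> (\<exists>c. \<forall>v. X $ v = sqrt (deg E v) *\<^sub>R c)"
  by (auto simp: null_space_def null_vec_nth vec_eq_iff)

lemma subspace_null_space: "subspace (null_space E :: (real^'d::finite^'v::finite) set)"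
  unfolding subspace_def
proof (intro conjI ballI allI)
  show "0 \<in> (null_space E :: (real^'d^'v) set)"
    by (auto simp: null_space_iff intro!: exI[of _ 0])
next
  fix X Y :: "real^'d^'v" assume "X \<in> null_space E" "Y \<in> null_space E"
  then show "X + Y \<in> null_space E"
    unfolding null_space_iff by (metis scaleR_add_right vector_add_component)
next
  fix X :: "real^'d^'v" and c :: real assume "X \<in> null_space E"
  then show "c *\<^sub>R X \<in> null_space E"
    unfolding null_space_iff by (metis scaleR_left_commute vector_scaleR_component)
qed

lemma grad_mult_eq_0_iff:
  fixes X :: "real^'d::finite^'v::finite"
  assumes wh: "weighted_hypergraph E \<omega>" and conn: "hypergraph_connected E"
  shows "grad_matrix E \<omega> ** X = 0 \<longleftrightarrow> X \<in> null_space E"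
proof
  \<comment> \<open>After this rescaling the null space consists of the constant families. A
    vanishing gradient makes \<open>Y v\<close> the mean of \<open>Y\<close> over each hyperedge
    containing \<open>v\<close>, since the positive weights cancel; so \<open>Y\<close> is constant
    on hyperedges and, along paths, everywhere.\<close>
  define Y where "Y v = X $ v /\<^sub>R sqrt (deg E v)" for v
  assume G0: "grad_matrix E \<omega> ** X = 0"
  have mean: "Y v = (\<Sum>u\<in>e. Y u) /\<^sub>R card e" if "e \<in> E" "v \<in> e" for e v
  proof -
    have "(grad_matrix E \<omega> ** X) $ (e, v) = 0" using G0 by simp
    then show ?thesis
      using that wh by (auto simp: grad_mult_nth Y_def incidences_def weighted_hypergraph_def)
  qed
  have Y_eq: "Y u = Y v" for u v
  proof -
    have "(u, v) \<in> {(x, y). \<exists>e\<in>E. x \<in> e \<and> y \<in> e}\<^sup>*"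
      using conn by (simp add: hypergraph_connected_def)
    then show ?thesis
    proof (induction rule: rtrancl_induct)
      case (step y z)
      then obtain e where "e \<in> E" "y \<in> e" "z \<in> e" by auto
      then have "Y y = Y z" using mean[of e y] mean[of e z] by simp
      then show ?case using step.IH by simp
    qed simp
  qed
  \<comment> \<open>\<open>undefined\<close> serves as an arbitrary reference node.\<close>
  have "X $ v = sqrt (deg E v) *\<^sub>R Y undefined" for v
    using connected_deg_pos[OF wh conn, of v] Y_eq[of undefined v] by (simp add: Y_def)
  then show "X \<in> null_space E" by (auto simp: null_space_iff)
next
  assume "X \<in> null_space E"
  then obtain c where c: "\<And>v. X $ v = sqrt (deg E v) *\<^sub>R c" by (auto simp: null_space_iff)
  have Xc: "X $ v /\<^sub>R sqrt (deg E v) = c" for v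
    using connected_deg_pos[OF wh conn, of v] by (simp add: c)
  have "card e \<noteq> 0" if "e \<in> E" for e
    using wh that by (auto simp: weighted_hypergraph_def)
  then have "(grad_matrix E \<omega> ** X) $ (e, v) = 0" for e v
    by (simp add: grad_mult_nth Xc sum_constant_scaleR incidences_def
        del: sum_constant card_0_eq)
  then show "grad_matrix E \<omega> ** X = 0" by (simp add: vec_eq_iff split_paired_all)
qed


section \<open>The spectral gap\<close>

text \<open>Ensures that the infimum defining \<open>lambda2\<close> is not taken over the empty
  set.\<close>

lemma orthogonal_comp_null_space_nontrivial:
  assumes wh: "weighted_hypergraph E \<omega>" and conn: "hypergraph_connected E"
  obtains Z :: "real^'d::finite^'v::finite"
  where "Z \<in> (null_space E)\<^sup>\<bottom>" and "norm Z = 1"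
proof -
  have "\<not> CARD('v) \<le> Suc 0" using wh by (simp add: weighted_hypergraph_def)
  then obtain a b :: 'v where ab: "a \<noteq> b"
    by (auto simp: card_le_Suc0_iff_eq)
  define c :: "real^'d" where "c = 1"
  \<comment> \<open>The roots of the degrees are exchanged between \<open>a\<close> and
    \<open>b\<close>, with opposite signs, so the two contributions cancel against rows
    \<open>sqrt (deg E v) *\<^sub>R k\<close>.\<close>
  define Z :: "real^'d^'v" where
    "Z = (\<chi> v. if v = a then sqrt (deg E b) *\<^sub>R c else if v = b then - sqrt (deg E a) *\<^sub>R c else 0)"
  have perp: "Z \<in> (null_space E)\<^sup>\<bottom>"
    unfolding orthogonal_comp_def orthogonal_def
  proof (intro CollectI ballI)
    fix Y :: "real^'d^'v" assume "Y \<in> null_space E"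
    then obtain k where k: "\<And>v. Y $ v = sqrt (deg E v) *\<^sub>R k" by (auto simp: null_space_iff)
    have "Y \<bullet> Z = (\<Sum>v\<in>{a, b}. Y $ v \<bullet> Z $ v)"
      unfolding inner_vec_def[of Y Z]
      by (rule sum.mono_neutral_right) (auto simp: Z_def)
    also have "\<dots> = 0" using ab by (simp add: Z_def k)
    finally show "Y \<bullet> Z = 0" .
  qed
  have "Z $ a \<noteq> 0"
    using connected_deg_pos[OF wh conn, of b] by (simp add: Z_def c_def)
  then have "Z \<noteq> 0" by auto
  then show thesis
    using that[of "Z /\<^sub>R norm Z"] subspace_scale[OF subspace_orthogonal_comp perp] by simp
qed

text \<open>The unit sphere of the orthogonal complement is compact and nonempty, and the energy is
  continuous; hence the \<open>Inf\<close> in \<open>lambda2\<close> is a true minimum.\<close>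

lemma lambda2_attained:
  fixes E :: "'v::finite set set"
  assumes wh: "weighted_hypergraph E \<omega>" and conn: "hypergraph_connected E"
  shows "lambda2 E \<omega> TYPE('d::finite) \<in> energy_values E \<omega> TYPE('d)"
    and "\<And>r. r \<in> energy_values E \<omega> TYPE('d) \<Longrightarrow> lambda2 E \<omega> TYPE('d) \<le> r"
proof -
  define K :: "(real^'d^'v) set" where "K = (null_space E)\<^sup>\<bottom> \<inter> sphere 0 1"
  have ev: "energy_values E \<omega> TYPE('d) = (\<lambda>Z. (norm (grad_matrix E \<omega> ** Z))\<^sup>2) ` K"
    by (auto simp: energy_values_def K_def)
  have "compact K"
    unfolding K_def
    by (intro closed_Int_compact closed_subspace subspace_orthogonal_comp compact_sphere)
  moreover obtain Z0 :: "real^'d^'v" where "Z0 \<in> (null_space E)\<^sup>\<bottom>" "norm Z0 = 1"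
    by (rule orthogonal_comp_null_space_nontrivial[OF wh conn])
  then have "K \<noteq> {}" by (auto simp: K_def)
  moreover have "continuous_on K (\<lambda>Z. (norm (grad_matrix E \<omega> ** Z))\<^sup>2)"
    using linear_matrix_mult_left[of "grad_matrix E \<omega>"]
    by (intro continuous_intros linear_continuous_on) (simp add: linear_linear)
  ultimately obtain Z where "Z \<in> K"
    "\<And>Y. Y \<in> K \<Longrightarrow> (norm (grad_matrix E \<omega> ** Z))\<^sup>2 \<le> (norm (grad_matrix E \<omega> ** Y))\<^sup>2"
    using continuous_attains_inf by metis
  then have "lambda2 E \<omega> TYPE('d) = (norm (grad_matrix E \<omega> ** Z))\<^sup>2"
    and "\<And>r. r \<in> energy_values E \<omega> TYPE('d) \<Longrightarrow> (norm (grad_matrix E \<omega> ** Z))\<^sup>2 \<le> r"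
    unfolding lambda2_def ev by (auto intro!: cInf_eq_minimum)
  with \<open>Z \<in> K\<close> show "lambda2 E \<omega> TYPE('d) \<in> energy_values E \<omega> TYPE('d)"
    and "\<And>r. r \<in> energy_values E \<omega> TYPE('d) \<Longrightarrow> lambda2 E \<omega> TYPE('d) \<le> r"
    unfolding ev by auto
qed

text \<open>A minimiser of zero energy would lie in the kernel of the gradient, hence in both the
  null space and its complement, contradicting norm 1.\<close>

lemma lambda2_pos:
  fixes E :: "'v::finite set set"
  assumes wh: "weighted_hypergraph E \<omega>" and conn: "hypergraph_connected E"
  shows "lambda2 E \<omega> TYPE('d::finite) > 0"
proof -
  obtain Z :: "real^'d^'v" where Z: "Z \<in> (null_space E)\<^sup>\<bottom>" "norm Z = 1"
    and lam: "lambda2 E \<omega> TYPE('d) = (norm (grad_matrix E \<omega> ** Z))\<^sup>2"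
    using lambda2_attained(1)[OF wh conn, where 'd='d] by (auto simp: energy_values_def)
  have "Z \<notin> null_space E"
  proof
    assume "Z \<in> null_space E"
    then have "Z \<bullet> Z = 0" using Z(1) by (auto simp: orthogonal_comp_def orthogonal_def)
    then show False using Z(2) by simp
  qed
  then show ?thesis using grad_mult_eq_0_iff[OF wh conn, of Z] lam by simp
qed

text \<open>Both sides are homogeneous of degree 2, so the case of norm 1 suffices.\<close>

lemma lambda2_le_energy:
  fixes Z :: "real^'d::finite^'v::finite"
  assumes wh: "weighted_hypergraph E \<omega>" and conn: "hypergraph_connected E"
    and Z: "Z \<in> (null_space E)\<^sup>\<bottom>"
  shows "lambda2 E \<omega> TYPE('d) * (norm Z)\<^sup>2 \<le> (norm (grad_matrix E \<omega> ** Z))\<^sup>2"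
proof (cases "Z = 0")
  case False
  have "Z /\<^sub>R norm Z \<in> (null_space E)\<^sup>\<bottom>" "norm (Z /\<^sub>R norm Z) = 1"
    using subspace_scale[OF subspace_orthogonal_comp Z] False by simp_all
  then have "(norm (grad_matrix E \<omega> ** (Z /\<^sub>R norm Z)))\<^sup>2 \<in> energy_values E \<omega> TYPE('d)"
    unfolding energy_values_def by blast
  then have "lambda2 E \<omega> TYPE('d) \<le> (norm (grad_matrix E \<omega> ** (Z /\<^sub>R norm Z)))\<^sup>2"
    by (rule lambda2_attained(2)[OF wh conn])
  also have "\<dots> = (norm (grad_matrix E \<omega> ** Z))\<^sup>2 / (norm Z)\<^sup>2"
    using linear_scale[OF linear_matrix_mult_left[of "grad_matrix E \<omega>"], of "inverse (norm Z)" Z]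
    by (simp add: power_mult_distrib divide_inverse power_inverse mult.commute)
  finally show ?thesis using False by (simp add: pos_le_divide_eq)
qed simp


section \<open>Dissipation\<close>

text \<open>The softmax part is nonnegative, and the uniform part alone already reaches the
  bound.\<close>

lemma a_min_le_attn_coeff:
  assumes "(e, v) \<in> incidences E" and "0 < \<epsilon>" "\<epsilon> < 1"
  shows "a_min E \<epsilon> \<le> attn_coeff E \<epsilon> \<alpha> Agg act \<theta> X e v"
proof -
  have "deg E v > 0" using assms(1) by (auto simp: deg_def incidences_def card_gt_0_iff)
  moreover have "deg E v \<le> max_deg E" by (simp add: max_deg_def)
  ultimately have "a_min E \<epsilon> \<le> \<epsilon> / deg E v"
    using assms(2) by (simp add: a_min_def frac_le)
  moreover have "0 \<le> (1 - \<epsilon>) * (exp (attn_score \<alpha> Agg act \<theta> X e v) /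
       (\<Sum>e' \<in> {e' \<in> E. v \<in> e'}. exp (attn_score \<alpha> Agg act \<theta> X e' v)))"
    using assms(3) by (simp add: sum_nonneg)
  ultimately show ?thesis by (simp add: attn_coeff_def)
qed

text \<open>By adjointness the left side is minus the form of the diagonal modulation matrix at
  \<open>grad_matrix E \<omega> ** X\<close>, which is bounded row by row.\<close>

lemma inner_diffusion_field_le:
  fixes X :: "real^'d::finite^'v::finite"
  assumes "0 < \<epsilon>" "\<epsilon> < 1"
  shows "X \<bullet> diffusion_field E \<omega> \<epsilon> \<alpha> Agg act \<theta> X \<le>
    - a_min E \<epsilon> * (norm (grad_matrix E \<omega> ** X))\<^sup>2"
proof -
  let ?G = "grad_matrix E \<omega>" and ?A = "mod_matrix E \<epsilon> \<alpha> Agg act \<theta> X"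
  have "a_min E \<epsilon> * (norm (?G ** X))\<^sup>2
      = (\<Sum>i\<in>UNIV. a_min E \<epsilon> * ((?G ** X) $ i \<bullet> (?G ** X) $ i))"
    by (simp only: power2_norm_eq_inner inner_vec_def[of "?G ** X"] sum_distrib_left)
  also have "\<dots> \<le> (\<Sum>i\<in>UNIV. (?G ** X) $ i \<bullet> (?A ** (?G ** X)) $ i)"
  proof (rule sum_mono)
    fix i :: "'v set \<times> 'v"
    obtain e v where i: "i = (e, v)" by fastforce
    show "a_min E \<epsilon> * ((?G ** X) $ i \<bullet> (?G ** X) $ i) \<le> (?G ** X) $ i \<bullet> (?A ** (?G ** X)) $ i"
    proof (cases "(e, v) \<in> incidences E")
      case True
      then show ?thesis
        using a_min_le_attn_coeff[OF True assms, of \<alpha> Agg act \<theta> X]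
        by (simp add: i mod_matrix_def diag_matrix_mult_nth mult_right_mono del: inner_eq_zero_iff)
    next
      \<comment> \<open>On padded rows the modulation entry is 0, below \<open>a_min\<close>, but
        the gradient row vanishes too.\<close>
      case False
      then show ?thesis by (simp add: i grad_mult_nth)
    qed
  qed
  also have "\<dots> = (?G ** X) \<bullet> (?A ** (?G ** X))"
    by (simp only: inner_vec_def[of "?G ** X"])
  also have "\<dots> = - (X \<bullet> diffusion_field E \<omega> \<epsilon> \<alpha> Agg act \<theta> X)"
    by (simp add: diffusion_field_def inner_transpose_mult[symmetric] matrix_mul_assoc)
  finally show ?thesis by simp
qed

section \<open>The component orthogonal to the null space and its decay\<close>

lemma Q_proj_props:
  fixes X :: "real^'d::finite^'v::finite"
  shows "X - Q_proj E X \<in> null_space E" "Q_proj E X \<in> (null_space E)\<^sup>\<bottom>"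
    and "Q_proj E X = 0 \<longleftrightarrow> X \<in> null_space E"
proof -
  note p = orth_proj_exists[OF subspace_null_space[of E], of X]
  show "X - Q_proj E X \<in> null_space E" "Q_proj E X \<in> (null_space E)\<^sup>\<bottom>"
    using p by (simp_all add: Q_proj_def)
  show "Q_proj E X = 0 \<longleftrightarrow> X \<in> null_space E"
  proof
    assume "X \<in> null_space E"
    then have "orth_proj (null_space E) X = X"
      by (intro orth_proj_unique subspace_null_space) (simp_all add: subspace_0 subspace_orthogonal_comp)
    then show "Q_proj E X = 0" by (simp add: Q_proj_def)
  qed (use p(1) in \<open>simp add: Q_proj_def\<close>)
qed

lemma bounded_linear_Q_proj: "bounded_linear (Q_proj E :: real^'d::finite^'v::finite \<Rightarrow> _)"
proof -
  have "linear (Q_proj E :: real^'d^'v \<Rightarrow> _)"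
    unfolding Q_proj_def[abs_def]
    by (intro linear_compose_sub linear_ident linear_orth_proj subspace_null_space)
  then show ?thesis by (simp add: linear_linear)
qed

lemma grad_mult_Q_proj:
  fixes X :: "real^'d::finite^'v::finite"
  assumes "weighted_hypergraph E \<omega>" "hypergraph_connected E"
  shows "grad_matrix E \<omega> ** Q_proj E X = grad_matrix E \<omega> ** X"
proof -
  have "grad_matrix E \<omega> ** (X - Q_proj E X) = 0"
    using grad_mult_eq_0_iff[OF assms] Q_proj_props(1) by blast
  then show ?thesis by (simp add: linear_diff[OF linear_matrix_mult_left])
qed

text \<open>Two orthogonalities allow both projections to be dropped: \<open>Q_proj E X\<close> is
  orthogonal to the null space, and the field lies in the range of the transposed gradient, hence is
  orthogonal to the kernel element \<open>X - Q_proj E X\<close>.\<close>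

lemma inner_Q_proj_diffusion_field:
  fixes X :: "real^'d::finite^'v::finite"
  assumes wh: "weighted_hypergraph E \<omega>" and conn: "hypergraph_connected E"
  shows "Q_proj E X \<bullet> Q_proj E (diffusion_field E \<omega> \<epsilon> \<alpha> Agg act \<theta> X) =
    X \<bullet> diffusion_field E \<omega> \<epsilon> \<alpha> Agg act \<theta> X"
proof -
  let ?F = "diffusion_field E \<omega> \<epsilon> \<alpha> Agg act \<theta> X"
  have "Q_proj E X \<bullet> (?F - Q_proj E ?F) = 0"
    using Q_proj_props(1)[of ?F E] Q_proj_props(2)[of E X]
    by (auto simp: orthogonal_comp_def orthogonal_def inner_commute)
  moreover have "(X - Q_proj E X) \<bullet> ?F = 0"
    using grad_mult_Q_proj[OF wh conn, of X]
    by (simp add: diffusion_field_def matrix_mul_assoc[symmetric] inner_transpose_mult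
        linear_diff[OF linear_matrix_mult_left])
  ultimately show ?thesis by (simp add: inner_diff_left inner_diff_right)
qed

text \<open>A Gronwall argument with an integrating factor: the squared norm decays at rate
  \<open>2 * \<gamma>\<close>, so \<open>g\<close> below is nonincreasing.\<close>

lemma Q_proj_decay:
  fixes x :: "real \<Rightarrow> real^'d::finite^'v::finite"
  assumes wh: "weighted_hypergraph E \<omega>" and conn: "hypergraph_connected E"
    and eps: "0 < \<epsilon>" "\<epsilon> < 1"
    and sol: "classical_solution (diffusion_field E \<omega> \<epsilon> \<alpha> Agg act \<theta>) x0 x"
    and t: "0 \<le> t"
  shows "norm (Q_proj E (x t)) \<le> exp (- (a_min E \<epsilon> * lambda2 E \<omega> TYPE('d)) * t) * norm (Q_proj E x0)"
proof -
  let ?F = "diffusion_field E \<omega> \<epsilon> \<alpha> Agg act \<theta>"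
  define \<gamma> where "\<gamma> = a_min E \<epsilon> * lambda2 E \<omega> TYPE('d)"
  define q where "q s = Q_proj E (x s)" for s
  define g where "g s = exp (2 * \<gamma> * s) * (q s \<bullet> q s)" for s
  define g' where
    "g' s = exp (2 * \<gamma> * s) * (2 * (q s \<bullet> Q_proj E (?F (x s))) + 2 * \<gamma> * (q s \<bullet> q s))" for s
  have x': "(x has_vector_derivative ?F (x s)) (at s within {0..})" if "s \<ge> 0" for s
    using sol that by (auto simp: classical_solution_def)
  have q': "(q has_vector_derivative Q_proj E (?F (x s))) (at s within {0..})" if "s \<ge> 0" for s
    unfolding q_def
    by (rule bounded_linear.has_vector_derivative[OF bounded_linear_Q_proj x'[OF that]])
  have g_deriv: "(g has_real_derivative g' s) (at s within {0..})" if "s \<ge> 0" for s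
  proof -
    have "((\<lambda>s. q s \<bullet> q s) has_real_derivative 2 * (q s \<bullet> Q_proj E (?F (x s))))
        (at s within {0..})"
      using has_derivative_inner[OF q'[OF that, unfolded has_vector_derivative_def]
          q'[OF that, unfolded has_vector_derivative_def]]
      unfolding has_field_derivative_def
      by (rule has_derivative_eq_rhs) (simp add: fun_eq_iff inner_commute)
    then show ?thesis
      unfolding g_def[abs_def] g'_def
      by (auto intro!: derivative_eq_intros simp: algebra_simps)
  qed
  have g'_le: "g' s \<le> 0" for s
  proof -
    have "a_min E \<epsilon> \<ge> 0" using eps by (simp add: a_min_def)
    \<comment> \<open>The spectral gap and the dissipation bound meet in the middle term
      \<open>a_min E \<epsilon> * (norm (grad_matrix E \<omega> ** q s))\<^sup>2\<close>.\<close>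
    then have "\<gamma> * (norm (q s))\<^sup>2 \<le> a_min E \<epsilon> * (norm (grad_matrix E \<omega> ** q s))\<^sup>2"
      using lambda2_le_energy[OF wh conn Q_proj_props(2), of "x s"]
      by (simp add: \<gamma>_def q_def mult.assoc mult_left_mono)
    moreover have "q s \<bullet> Q_proj E (?F (x s)) \<le> - a_min E \<epsilon> * (norm (grad_matrix E \<omega> ** q s))\<^sup>2"
      unfolding q_def inner_Q_proj_diffusion_field[OF wh conn] grad_mult_Q_proj[OF wh conn]
      by (rule inner_diffusion_field_le[OF eps])
    ultimately have "2 * (q s \<bullet> Q_proj E (?F (x s))) + 2 * \<gamma> * (q s \<bullet> q s) \<le> 0"
      by (simp add: power2_norm_eq_inner)
    then show ?thesis unfolding g'_def by (simp add: mult_le_0_iff)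
  qed
  have "g t \<le> g 0"
  proof (rule DERIV_nonpos_imp_decreasing_open[OF t])
    fix s :: real assume "0 < s" "s < t"
    \<comment> \<open>At interior times the derivative within \<open>{0..}\<close> is two-sided; at
      the endpoints continuity suffices.\<close>
    then have "(g has_real_derivative g' s) (at s)"
      using g_deriv[of s] at_within_interior[of s "{0..}"] by simp
    then show "\<exists>y. (g has_real_derivative y) (at s) \<and> y \<le> 0"
      using g'_le by blast
  next
    have "continuous_on {0..} g"
      using g_deriv by (auto intro!: DERIV_continuous_on)
    then show "continuous_on {0..t} g" by (rule continuous_on_subset) auto
  qed
  \<comment> \<open>The factor 2 in the exponent makes \<open>g t\<close> a perfect square, so roots
    can be taken.\<close>
  then have "(exp (\<gamma> * t) * norm (q t))\<^sup>2 \<le> (norm (q 0))\<^sup>2"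
    by (simp add: g_def power_mult_distrib power2_norm_eq_inner exp_double[symmetric] mult.assoc)
  then have "exp (\<gamma> * t) * norm (q t) \<le> norm (q 0)"
    by (rule power2_le_imp_le) simp
  then have "norm (q t) \<le> exp (- \<gamma> * t) * norm (q 0)"
    by (simp add: exp_minus field_simps)
  then show ?thesis using sol by (simp add: q_def \<gamma>_def classical_solution_def)
qed

text \<open>Decay from 0 keeps the solution in the null space, where the field vanishes. Fixing
  every point yields equality, not mere inclusion, in the invariance claim.\<close>

lemma null_space_stationary:
  fixes x :: "real \<Rightarrow> real^'d::finite^'v::finite"
  assumes wh: "weighted_hypergraph E \<omega>" and conn: "hypergraph_connected E"
    and eps: "0 < \<epsilon>" "\<epsilon> < 1"
    and sol: "classical_solution (diffusion_field E \<omega> \<epsilon> \<alpha> Agg act \<theta>) x0 x"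
    and x0: "x0 \<in> null_space E" and t: "0 \<le> t"
  shows "x t = x0"
proof -
  have null: "x s \<in> null_space E" if "s \<ge> 0" for s
    using Q_proj_decay[OF wh conn eps sol that] x0 Q_proj_props(3)[of E x0] Q_proj_props(3)[of E "x s"]
    by simp
  have "(x has_vector_derivative 0) (at s within {0..})" if "s \<in> {0..}" for s
  proof -
    have "diffusion_field E \<omega> \<epsilon> \<alpha> Agg act \<theta> (x s) = 0"
      using null[of s] that grad_mult_eq_0_iff[OF wh conn, of "x s"]
      by (simp add: diffusion_field_def matrix_mul_assoc[symmetric])
    then show ?thesis using sol that by (auto simp: classical_solution_def)
  qed
  then obtain c where "\<And>s. s \<in> {0..} \<Longrightarrow> x s = c"
    using has_vector_derivative_zero_constant[of "{0..}" x] by auto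
  then show ?thesis using t sol by (simp add: classical_solution_def)
qed

theorem theorem3:
  fixes E :: "'v::finite set set"
    and \<omega> :: "'v set \<Rightarrow> real"
    and \<epsilon> \<alpha> :: real
    and Agg :: "(real^'d::finite) multiset \<Rightarrow> real^'d"
    and act :: "nat \<Rightarrow> real \<Rightarrow> real"
    and \<theta> :: "('d + 'd) mlp_params"
    and S :: "real \<Rightarrow> real^'d^'v \<Rightarrow> real^'d^'v"
  assumes "weighted_hypergraph E \<omega>"
    and "hypergraph_connected E"
    and "0 < \<epsilon>" and "\<epsilon> < 1"
    and "0 < \<alpha>" and "\<alpha> < 1"
    and "\<And>e. e \<in> E \<Longrightarrow> locally_lipschitz (\<lambda>X :: real^'d^'v. edge_feature Agg X e)"
    and "locally_lipschitz (mlp act \<theta>)"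
    and "semiflow_generated_by (diffusion_field E \<omega> \<epsilon> \<alpha> Agg act \<theta>) S"
  shows "let lam2 = lambda2 E \<omega> TYPE('d); \<gamma> = a_min E \<epsilon> * lam2 in
    (\<forall>t\<ge>0. S t ` null_space E = null_space E) \<and>
    lam2 \<in> energy_values E \<omega> TYPE('d) \<and>
    lam2 > 0 \<and> \<gamma> > 0 \<and>
    (\<forall>X0. \<forall>t\<ge>0.
       infdist (S t X0) (null_space E) = norm (Q_proj E (S t X0)) \<and>
       norm (Q_proj E (S t X0)) \<le> exp (- \<gamma> * t) * norm (Q_proj E X0))"
proof -
  let ?l = "lambda2 E \<omega> TYPE('d)"
  note wh = assms(1) and conn = assms(2) and eps = assms(3,4)
  have sol: "classical_solution (diffusion_field E \<omega> \<epsilon> \<alpha> Agg act \<theta>) X0 (\<lambda>t. S t X0)" for X0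
    using assms(9) by (simp add: semiflow_generated_by_def)
  have "S t ` null_space E = null_space E" if "t \<ge> 0" for t
    using null_space_stationary[OF wh conn eps sol _ that] by force
  moreover have "infdist X (null_space E) = norm (Q_proj E X)" for X :: "real^'d^'v"
    by (simp add: infdist_subspace[OF subspace_null_space] Q_proj_def)
  moreover have "a_min E \<epsilon> > 0"
  proof -
    \<comment> \<open>The degree of any one node, here \<open>undefined\<close>, bounds
      \<open>max_deg E\<close> away from 0.\<close>
    have "0 < deg E undefined" by (rule connected_deg_pos[OF wh conn])
    also have "\<dots> \<le> max_deg E" by (simp add: max_deg_def)
    finally show ?thesis using eps by (simp add: a_min_def)
  qed
  ultimately show ?thesis
    using lambda2_attained(1)[OF wh conn, where 'd='d] lambda2_pos[OF wh conn, where 'd='d]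
      Q_proj_decay[OF wh conn eps sol]
    by (simp add: Let_def)
qed

end
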